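(* A natural number $n$ satisfies $D(n)\le 1$ if and only if it can be written in one of the following forms (where $a,b,k,\ell$ denote nonnegative integers), and in each case the complexity $\|n\|$ is as indicated: (1) $n=1$, of complexity $1$; (2) $n=2^a3^k$ for $a\le 10$, of complexity $2a+3k$ (for $a$, $k$ not both zero); (3) $n=2^a(2^b3^\ell+1)3^k$ for $a+b\le 2$, of complexity $2(a+b)+3(\ell+k)+1$ (for $b$, $\ell$ not both zero).
   Context: Natural numbers are positive integers. The complexity $\|n\|$ of a natural number $n$ is the least number of $1$'s needed to write $n$ using any combination of addition and multiplication (with arbitrary parenthesization). For $k\ge 1$, $E(k)$ is the largest natural number $n$ with $\|n\|\le k$. $L(n)$ is the largest $k\ge 1$ with $E(k)\le n$, and the integer defect of $n$ is $D(n)=\|n\|-L(n)$. *)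

theory Defs
  imports Main
begin

text \<open>
  Natural numbers are positive throughout: no expression below has value \<open>0\<close>, so
  \<open>complexity 0\<close> is unspecified and \<open>0\<close> is excluded explicitly where it could matter.
\<close>

datatype expr = One | Add expr expr | Mult expr expr

fun val :: "expr \<Rightarrow> nat" where
  "val One = 1"
| "val (Add s t) = val s + val t"
| "val (Mult s t) = val s * val t"

fun ones :: "expr \<Rightarrow> nat" where
  "ones One = 1"
| "ones (Add s t) = ones s + ones t"
| "ones (Mult s t) = ones s + ones t"

definition complexity :: "nat \<Rightarrow> nat" where
  "complexity n = (LEAST m. \<exists>t. val t = n \<and> ones t = m)"

text \<open>
  \<open>E k\<close> is only meaningful for \<open>k \<ge> 1\<close>, and \<open>L n\<close> for \<open>n \<ge> 1\<close>. For such arguments both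
  sets are nonempty and finite: \<open>m\<close> ones produce at most the value \<open>2 ^ m\<close>, and \<open>E k \<ge> k\<close>.
\<close>

definition E :: "nat \<Rightarrow> nat" where
  "E k = Max {n. n \<ge> 1 \<and> complexity n \<le> k}"

definition L :: "nat \<Rightarrow> nat" where
  "L n = Max {k. k \<ge> 1 \<and> E k \<le> n}"

definition D :: "nat \<Rightarrow> int" where
  "D n = int (complexity n) - int (L n)"

end

theory Submission
  imports Defs
begin

text \<open>
  With the convention \<open>E 0 = 1\<close>, \<open>E\<close> is supermultiplicative and \<open>D n \<le> 1\<close> means that \<open>n > E (k - 1)\<close>, where
  \<open>k\<close> is the complexity of \<open>n\<close>. If a product \<open>x * y\<close>, written with \<open>i + j\<close> ones, exceeds
  \<open>E (i + j - 1) \<ge> E (i - 1) * E j\<close>, then \<open>x > E (i - 1)\<close> and likewise \<open>y > E (j - 1)\<close>, so both factors are of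
  the same kind. A sum exceeding \<open>E (i + j - 1)\<close> must be \<open>E i + 1\<close>, up to tiny cases, because
  \<open>E i + E j\<close> is too small otherwise. Induction on expressions thus leaves only the products of two listed
  numbers to be compared with \<open>E\<close>. Conversely, each listed form exceeds \<open>E (k - 1)\<close>
  for the claimed complexity \<open>k\<close>, and this forces its complexity to be exactly \<open>k\<close>.
\<close>

section \<open>The largest value of a given number of ones\<close>

text \<open>Tripling for three more ones is valid only from argument 2 on, since the values at 1 and
  4 are 1 and 4; hence the five base cases.\<close>

fun max_val :: "nat \<Rightarrow> nat" where
  "max_val 0 = 1"
| "max_val (Suc 0) = 1"
| "max_val (Suc (Suc 0)) = 2"
| "max_val (Suc (Suc (Suc 0))) = 3"
| "max_val (Suc (Suc (Suc (Suc 0)))) = 4"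
| "max_val (Suc (Suc (Suc (Suc (Suc n))))) = 3 * max_val (Suc (Suc n))"

lemma max_val_add_3:
  assumes "k \<ge> 2" shows "max_val (k + 3) = 3 * max_val k"
proof -
  obtain m where "k = Suc (Suc m)"
    using assms by (metis add_2_eq_Suc le_Suc_ex)
  then show ?thesis by (simp add: eval_nat_numeral)
qed

lemma max_val_pos: "max_val k \<ge> 1"
  by (induction k rule: max_val.induct) auto

text \<open>Adding three ones to an argument that is at least 2 triples both sides, so only small
  pairs have to be computed.\<close>

lemma max_val_mult_le: "max_val i * max_val j \<le> max_val (i + j)"
proof (induction i arbitrary: j rule: max_val.induct)
  case 1 show ?case by simp
next
  case 2 show ?case by (induction j rule: max_val.induct) auto
next
  case 3 show ?case by (induction j rule: max_val.induct) auto
next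
  case 4 show ?case by (induction j rule: max_val.induct) auto
next
  case 5 show ?case by (induction j rule: max_val.induct) auto
next
  case (6 n) then show ?case by (simp add: mult.assoc)
qed

lemma max_val_mono:
  assumes "i \<le> j" shows "max_val i \<le> max_val j"
proof -
  have "max_val i \<le> max_val i * max_val (j - i)"
    using max_val_pos[of "j - i"] by simp
  then show ?thesis using max_val_mult_le[of i "j - i"] assms by (metis le_add_diff_inverse le_trans)
qed

lemma Suc_max_val_le: "j \<ge> 1 \<Longrightarrow> Suc (max_val j) \<le> max_val (Suc j)"
  by (induction j rule: max_val.induct) auto

lemma max_val_ge_2: "k \<ge> 2 \<Longrightarrow> max_val k \<ge> 2"
  using max_val_mono[of 2 k] by (simp add: eval_nat_numeral)

lemma add_le_mult_nat: "x \<ge> 2 \<Longrightarrow> y \<ge> 2 \<Longrightarrow> x + y \<le> x * (y :: nat)"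
proof -
  assume "x \<ge> 2" "y \<ge> 2"
  then obtain r s where "x = 2 + r" "y = 2 + s" using le_Suc_ex by metis
  then show ?thesis by (simp add: algebra_simps)
qed

text \<open>The sum of two numbers that are at least 2 is at most their product; an argument 1 is
  covered by strict growth.\<close>

lemma max_val_add_le:
  assumes "i \<ge> 1" "j \<ge> 1" shows "max_val i + max_val j \<le> max_val (i + j)"
proof -
  consider "i = 1" | "j = 1" | "i \<ge> 2" "j \<ge> 2" using assms by linarith
  then show ?thesis
  proof cases
    case 3
    then show ?thesis
      using add_le_mult_nat[OF max_val_ge_2 max_val_ge_2] max_val_mult_le[of i j]
      by (meson le_trans)
  qed (use assms Suc_max_val_le[of i] Suc_max_val_le[of j] in auto)
qed

lemma ones_pos: "ones t \<ge> 1"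
  by (induction t) auto

lemma val_le_max_val: "val t \<le> max_val (ones t)"
proof (induction t)
  case (Add s t)
  then show ?case using max_val_add_le[OF ones_pos[of s] ones_pos[of t]] by simp
next
  case (Mult s t)
  then show ?case
    using max_val_mult_le[of "ones s" "ones t"] mult_le_mono by (metis le_trans ones.simps(3) val.simps(3))
qed simp

text \<open>Three factors 2 are worse than two factors 3, both costing six ones. As
  \<open>2 * b\<close> meets every residue modulo 3 for \<open>b <= 2\<close>, this is a closed
  formula for all arguments from 2 on.\<close>

lemma max_val_power_2_3:
  assumes "b \<le> 2" shows "max_val (2 * b + 3 * l) = 2 ^ b * 3 ^ l"
proof (induction l)
  case 0
  have "b = 0 \<or> b = 1 \<or> b = 2" using assms by auto
  then show ?case by (auto simp: eval_nat_numeral)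
next
  case (Suc l)
  show ?case
  proof (cases "2 * b + 3 * l \<ge> 2")
    case True
    then show ?thesis using max_val_add_3[OF True] Suc by (simp add: algebra_simps)
  next
    case False
    then have "b = 0" "l = 0" by auto
    then show ?thesis by (simp add: eval_nat_numeral)
  qed
qed

text \<open>The even arguments up to 22 are the values \<open>2 * a + 2\<close> with
  \<open>a <= 10\<close> needed in \<open>max_val_less_power_form\<close>; the odd ones serve later
  numerical comparisons.\<close>

lemma max_val_numeral [simp]:
  "max_val 2 = 2"
  "max_val 3 = 3"
  "max_val 4 = 4"
  "max_val 6 = 9"
  "max_val 8 = 18"
  "max_val 9 = 27"
  "max_val 10 = 36"
  "max_val 12 = 81"
  "max_val 14 = 162"
  "max_val 16 = 324"
  "max_val 18 = 729"
  "max_val 20 = 1458"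
  "max_val 21 = 2187"
  "max_val 22 = 2916"
  using max_val_power_2_3[of 1 0]
    max_val_power_2_3[of 0 1]
    max_val_power_2_3[of 2 0]
    max_val_power_2_3[of 0 2]
    max_val_power_2_3[of 1 2]
    max_val_power_2_3[of 0 3]
    max_val_power_2_3[of 2 2]
    max_val_power_2_3[of 0 4]
    max_val_power_2_3[of 1 4]
    max_val_power_2_3[of 2 4]
    max_val_power_2_3[of 0 6]
    max_val_power_2_3[of 1 6]
    max_val_power_2_3[of 0 7]
    max_val_power_2_3[of 2 6]
  by simp_all

lemma max_val_eq_power_2_3:
  assumes "k \<ge> 2" obtains b l where "b \<le> 2" "k = 2 * b + 3 * l" "max_val k = 2 ^ b * 3 ^ l"
proof -
  have "\<exists>b l. b \<le> 2 \<and> k = 2 * b + 3 * l"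
  proof -
    have "k mod 3 = 0 \<or> k mod 3 = 1 \<or> k mod 3 = 2" by auto
    moreover have "k = 2 * 0 + 3 * (k div 3)" if "k mod 3 = 0" using that by presburger
    \<comment> \<open>Here \<open>k >= 2\<close> excludes \<open>k = 1\<close>, so the subtraction
      is not truncated.\<close>
    moreover have "k = 2 * 2 + 3 * (k div 3 - 1)" if "k mod 3 = 1" using that assms by presburger
    moreover have "k = 2 * 1 + 3 * (k div 3)" if "k mod 3 = 2" using that by presburger
    ultimately show ?thesis
      by (metis le_refl one_le_numeral zero_le)
  qed
  then show ?thesis using that max_val_power_2_3 by blast
qed

text \<open>Together with \<open>max_val_power_3_mult_le\<close>, this spreads a single comparison
  such as \<open>2 ^ 11 <= max_val 21\<close> to all larger exponents.\<close>

lemma max_val_power_2_mult_le: "2 ^ m * max_val k \<le> max_val (2 * m + k)"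
proof (induction m)
  case (Suc m)
  have "2 * max_val (2 * m + k) \<le> max_val (2 + (2 * m + k))"
    using max_val_mult_le[of 2 "2 * m + k"] by (simp add: eval_nat_numeral)
  then show ?case using Suc by simp
qed simp

lemma max_val_power_3_mult_le: "3 ^ m * max_val k \<le> max_val (3 * m + k)"
  using max_val_mult_le[of "3 * m" k] max_val_power_2_3[of 0 m] by simp

section \<open>Complexity and the integer defect\<close>

definition writable :: "nat \<Rightarrow> nat \<Rightarrow> bool" where
  "writable n k \<longleftrightarrow> (\<exists>t. val t = n \<and> ones t = k)"

lemma writable_1: "writable 1 1"
  unfolding writable_def by (rule exI[of _ One]) simp

lemma writable_add: "writable m i \<Longrightarrow> writable n j \<Longrightarrow> writable (m + n) (i + j)"
  unfolding writable_def by (metis val.simps(2) ones.simps(2))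

lemma writable_mult: "writable m i \<Longrightarrow> writable n j \<Longrightarrow> writable (m * n) (i + j)"
  unfolding writable_def by (metis val.simps(3) ones.simps(3))

lemma writable_2: "writable 2 2"
  using writable_add[OF writable_1 writable_1] by (simp add: numeral_2_eq_2)

lemma writable_3: "writable 3 3"
  using writable_add[OF writable_1 writable_2] by (simp add: numeral_3_eq_3)

lemma writable_mult_power_2_3:
  assumes "writable n k" shows "writable (2 ^ a * n * 3 ^ c) (2 * a + k + 3 * c)"
proof -
  have "writable (2 ^ a * n) (2 * a + k)"
  proof (induction a)
    case (Suc a)
    then show ?case using writable_mult[OF writable_2 Suc] by (simp add: mult.assoc)
  qed (use assms in simp)
  then show ?thesis
  proof (induction c)
    case (Suc c)
    then show ?case using writable_mult[OF Suc.IH[OF Suc.prems] writable_3]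
      by (simp add: algebra_simps)
  qed simp
qed

text \<open>The empty product would cost no ones, so the construction starts from an actual factor 2
  or 3.\<close>

lemma writable_power_2_3:
  assumes "\<not> (a = 0 \<and> k = 0)" shows "writable (2 ^ a * 3 ^ k) (2 * a + 3 * k)"
proof (cases a)
  case 0
  then obtain k' where "k = Suc k'" using assms by (cases k) auto
  then show ?thesis using 0 writable_mult_power_2_3[OF writable_3, of 0 k'] by simp
next
  case (Suc a')
  then show ?thesis using writable_mult_power_2_3[OF writable_2, of a' k] by (simp add: algebra_simps)
qed

lemma writable_Suc_form:
  assumes "\<not> (b = 0 \<and> l = 0)"
  shows "writable (2 ^ a * (2 ^ b * 3 ^ l + 1) * 3 ^ k) (2 * (a + b) + 3 * (l + k) + 1)"
  using writable_mult_power_2_3[OF writable_add[OF writable_power_2_3[OF assms] writable_1], of a k]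
  by (simp add: algebra_simps)

lemma writable_max_val:
  assumes "k \<ge> 1" shows "writable (max_val k) k"
proof (cases "k = 1")
  case True
  then show ?thesis using writable_1 by simp
next
  case False
  then have "k \<ge> 2" using assms by simp
  then obtain b l where bl: "k = 2 * b + 3 * l" "max_val k = 2 ^ b * 3 ^ l"
    by (rule max_val_eq_power_2_3)
  then show ?thesis using writable_power_2_3[of b l] \<open>k \<ge> 2\<close> by (cases "b = 0 \<and> l = 0") auto
qed

lemma complexity_le: "writable n k \<Longrightarrow> complexity n \<le> k"
  unfolding complexity_def writable_def by (rule Least_le)

lemma writable_complexity:
  assumes "n \<ge> 1" shows "writable n (complexity n)"
proof -
  have "\<exists>k. writable n k" using assms
  proof (induction n rule: dec_induct)
    case base show ?case using writable_1 by blast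
  next
    case (step n) then show ?case using writable_add[OF _ writable_1] by fastforce
  qed
  then show ?thesis unfolding complexity_def writable_def by (rule LeastI_ex)
qed

lemma writable_le_max_val: "writable n k \<Longrightarrow> n \<le> max_val k"
  unfolding writable_def using val_le_max_val by blast

lemma le_max_val_complexity: "n \<ge> 1 \<Longrightarrow> n \<le> max_val (complexity n)"
  using writable_le_max_val writable_complexity by blast

lemma complexity_pos: "n \<ge> 1 \<Longrightarrow> complexity n \<ge> 1"
  using writable_complexity[of n] ones_pos unfolding writable_def by metis

lemma E_eq_max_val:
  assumes "k \<ge> 1" shows "E k = max_val k"
  unfolding E_def
proof (rule Max_eqI)
  have le: "n \<le> max_val k" if "n \<in> {n. 1 \<le> n \<and> complexity n \<le> k}" for n
    using that le_max_val_complexity[of n] max_val_mono[of "complexity n" k] by auto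
  then show "finite {n. 1 \<le> n \<and> complexity n \<le> k}"
    by (meson finite_nat_set_iff_bounded_le)
  show "n \<le> max_val k" if "n \<in> {n. 1 \<le> n \<and> complexity n \<le> k}" for n
    using le that .
  show "max_val k \<in> {n. 1 \<le> n \<and> complexity n \<le> k}"
    using complexity_le[OF writable_max_val[OF assms]] max_val_pos[of k] by simp
qed

lemma le_max_val: "k \<le> max_val k"
  by (induction k rule: max_val.induct) auto

text \<open>By monotonicity the set defining \<open>L n\<close> is closed downward among positive
  numbers, and \<open>k <= max_val k\<close> bounds it by \<open>n\<close>.\<close>

lemma le_L_iff:
  assumes "n \<ge> 1" "k \<ge> 1" shows "k \<le> L n \<longleftrightarrow> max_val k \<le> n"
proof -
  let ?S = "{k. k \<ge> 1 \<and> E k \<le> n}"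
  have S: "?S = {k. k \<ge> 1 \<and> max_val k \<le> n}" using E_eq_max_val by auto
  have "?S \<subseteq> {..n}" unfolding S using le_max_val le_trans by blast
  then have fin: "finite ?S" using finite_subset by blast
  have "1 \<in> ?S" unfolding S using assms by simp
  then have "?S \<noteq> {}" by blast
  then have "k \<le> L n \<longleftrightarrow> (\<exists>m\<in>?S. k \<le> m)" unfolding L_def using fin by (simp add: Max_ge_iff)
  also have "\<dots> \<longleftrightarrow> max_val k \<le> n" unfolding S using assms max_val_mono[of k] by (auto intro: le_trans)
  finally show ?thesis .
qed

text \<open>The defect condition says \<open>max_val (k - 1) <= n\<close> for the complexity
  \<open>k\<close>; equality would write \<open>n\<close> with only \<open>k - 1\<close> ones. The
  equivalence fails at \<open>n = 1\<close>, where \<open>D 1 = 0\<close> but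
  \<open>max_val 0 = 1\<close>.\<close>

lemma D_le_1_iff:
  assumes "n \<ge> 2" shows "D n \<le> 1 \<longleftrightarrow> max_val (complexity n - 1) < n"
proof -
  define k where "k = complexity n"
  have n: "n \<le> max_val k" using le_max_val_complexity[of n] assms k_def by simp
  then have k: "k \<ge> 2" using assms by (cases k rule: max_val.cases) auto
  have "max_val (k - 1) \<noteq> n"
  proof
    assume "max_val (k - 1) = n"
    then have "k \<le> k - 1" using complexity_le[OF writable_max_val[of "k - 1"]] k k_def by simp
    then show False using k by simp
  qed
  moreover have "D n \<le> 1 \<longleftrightarrow> k - 1 \<le> L n" unfolding D_def k_def[symmetric] using k by linarith
  ultimately show ?thesis using le_L_iff[of n "k - 1"] assms k unfolding k_def by auto
qed

lemma complexity_eqI: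
  assumes "writable n k" "max_val (k - 1) < n" shows "complexity n = k"
proof (rule ccontr)
  assume "complexity n \<noteq> k"
  then have "complexity n \<le> k - 1" using complexity_le[OF assms(1)] by simp
  then show False
    using le_max_val_complexity[of n] max_val_mono[of "complexity n" "k - 1"] assms by linarith
qed

section \<open>Classification\<close>

text \<open>The second argument counts the ones of the indicated expression, not the complexity, so
  that an induction on arbitrary expressions can carry it along.\<close>

definition power_form :: "nat \<Rightarrow> nat \<Rightarrow> bool" where
  "power_form n k \<longleftrightarrow> (\<exists>a c. a \<le> 10 \<and> \<not> (a = 0 \<and> c = 0) \<and> n = 2 ^ a * 3 ^ c \<and> k = 2 * a + 3 * c)"

definition Suc_form :: "nat \<Rightarrow> nat \<Rightarrow> bool" where
  "Suc_form n k \<longleftrightarrow> (\<exists>a b c l. a + b \<le> 2 \<and> \<not> (b = 0 \<and> l = 0) \<and>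
     n = 2 ^ a * (2 ^ b * 3 ^ l + 1) * 3 ^ c \<and> k = 2 * (a + b) + 3 * (l + c) + 1)"

section \<open>Listed forms exceed the maximum for one fewer 1\<close>

lemma max_val_less_power_form:
  assumes "power_form n k" shows "max_val (k - 1) < n"
proof -
  obtain a c where a: "a \<le> 10" "\<not> (a = 0 \<and> c = 0)" and n: "n = 2 ^ a * 3 ^ c" and k: "k = 2 * a + 3 * c"
    using assms unfolding power_form_def by blast
  show ?thesis
  \<comment> \<open>Tripling needs \<open>k - 1 >= 2\<close>; otherwise only \<open>n = 2\<close>
    remains.\<close>
  proof (cases "2 * a + 3 * c \<le> 2")
    case True
    then have "a = 1 \<and> c = 0" using a by auto
    then show ?thesis using n k by simp
  next
    case False
    then have k3: "k - 1 \<ge> 2" using k by simp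
    \<comment> \<open>Multiplying by 3 replaces the subtraction by \<open>k - 1 + 3\<close>;
      afterwards the factors \<open>3 ^ c\<close> cancel and a finite check in \<open>a\<close> is
      left.\<close>
    have "3 * max_val (k - 1) = max_val (2 * a + 3 * c + 2)"
      using max_val_add_3[OF k3] k k3 by (simp add: add.commute)
    moreover have "max_val (2 * a + 3 * c + 2) = 3 ^ c * max_val (2 * a + 2)"
    proof (induction c)
      case (Suc c)
      then show ?case using max_val_add_3[of "2 * a + 3 * c + 2"] by (simp add: add.commute add.left_commute)
    qed simp
    \<comment> \<open>At \<open>a = 10\<close> this reads 2916 < 3072; at \<open>a = 11\<close> it
      would fail.\<close>
    moreover have "max_val (2 * a + 2) < 3 * 2 ^ a"
    proof -
      have "a \<in> {0,1,2,3,4,5,6,7,8,9,10}" using a(1) by simp presburger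
      then show ?thesis by (elim insertE emptyE) simp_all
    qed
    ultimately have "3 * max_val (k - 1) < 3 ^ c * (3 * 2 ^ a)" by simp
    then show ?thesis using n by (simp add: mult.commute)
  qed
qed

lemma max_val_less_Suc_form:
  assumes "Suc_form n k" shows "max_val (k - 1) < n"
proof -
  obtain a b c l where a: "a + b \<le> 2" and n: "n = 2 ^ a * (2 ^ b * 3 ^ l + 1) * 3 ^ c"
    and k: "k = 2 * (a + b) + 3 * (l + c) + 1"
    using assms unfolding Suc_form_def by blast
  \<comment> \<open>Because \<open>a + b <= 2\<close>, dropping the \<open>+ 1\<close> leaves
    exactly the maximum for \<open>k - 1\<close> ones.\<close>
  have "max_val (k - 1) = 2 ^ (a + b) * 3 ^ (l + c)" using max_val_power_2_3[OF a, of "l + c"] k by simp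
  also have "\<dots> < n" unfolding n by (simp add: power_add algebra_simps)
  finally show ?thesis .
qed

section \<open>Large values of the listed shapes have small powers of 2\<close>

lemma power_formI:
  assumes "max_val (2 * a + 3 * c - 1) < 2 ^ a * 3 ^ c"
  shows "power_form (2 ^ a * 3 ^ c) (2 * a + 3 * c)"
proof -
  have "a \<le> 10"
  proof (rule ccontr)
    assume "\<not> a \<le> 10"
    then have "a = (a - 11) + 11" by simp
    then obtain m where m: "a = m + 11" ..
    \<comment> \<open>Eleven factors 2 cost 22 ones, yet 2048 <= 2187 = \<open>3 ^ 7\<close>, which
      costs only 21.\<close>
    have "2 ^ a \<le> 2 ^ m * max_val 21" using m by (simp add: power_add)
    also have "\<dots> \<le> max_val (2 * m + 21)" by (rule max_val_power_2_mult_le)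
    finally have "2 ^ a * 3 ^ c \<le> 3 ^ c * max_val (2 * m + 21)" by simp
    also have "\<dots> \<le> max_val (3 * c + (2 * m + 21))" by (rule max_val_power_3_mult_le)
    finally show False using assms m by (simp add: add.commute add.left_commute)
  qed
  moreover have "\<not> (a = 0 \<and> c = 0)" by (intro notI) (use assms in simp)
  ultimately show ?thesis unfolding power_form_def by blast
qed

lemma exponent_less_2:
  assumes "2 ^ b * 3 ^ l < (8 :: nat)" shows "l < 2"
proof (rule ccontr)
  assume "\<not> l < 2"
  then have "(3 :: nat) ^ 2 \<le> 3 ^ l" by (intro power_increasing) auto
  also have "\<dots> \<le> 2 ^ b * 3 ^ l" by simp
  finally show False using assms by simp
qed

text \<open>The \<open>+ 1\<close> gains a factor of at most 9/8. Trading three factors 2 for two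
  factors 3 gains exactly 9/8 with the same number of ones, so the final 1 is saved.\<close>

lemma Suc_form_bound:
  assumes "p + b \<ge> 3" "2 ^ b * 3 ^ l \<ge> (8 :: nat)"
  shows "2 ^ p * (2 ^ b * 3 ^ l + 1) * 3 ^ c \<le> max_val (2 * (p + b) + 3 * (l + c))"
proof -
  obtain m where m: "p + b = m + 3" using assms(1) by (metis add.commute le_Suc_ex)
  have "8 * (2 ^ p * (2 ^ b * 3 ^ l + 1) * 3 ^ c) \<le> 2 ^ p * (9 * (2 ^ b * 3 ^ l)) * (3 ^ c :: nat)"
    using assms(2) by simp
  also have "\<dots> = 9 * 2 ^ (p + b) * 3 ^ (l + c)" by (simp add: power_add algebra_simps)
  also have "\<dots> = 8 * (3 ^ (l + c) * (2 ^ m * max_val 6))"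
    unfolding m by (simp add: power_add)
  also have "\<dots> \<le> 8 * max_val (3 * (l + c) + (2 * m + 6))"
    using max_val_power_2_mult_le[of m 6] max_val_power_3_mult_le[of "l + c" "2 * m + 6"]
    by (meson le_trans mult_le_mono2)
  also have "3 * (l + c) + (2 * m + 6) = 2 * (p + b) + 3 * (l + c)" using m by simp
  finally show ?thesis by simp
qed

text \<open>
  The identities \<open>2 * 5 = 3^2 + 1\<close> and \<open>4 * 7 = 3^3 + 1\<close>, which respect the number of ones, absorb the
  excess powers of \<open>2\<close> that the bound above does not exclude.
\<close>

lemma Suc_formI:
  assumes "b \<le> 2" "\<not> (b = 0 \<and> l = 0)"
    and n: "n = 2 ^ p * (2 ^ b * 3 ^ l + 1) * 3 ^ c" and k: "k = 2 * (p + b) + 3 * (l + c) + 1"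
    and big: "max_val (k - 1) < n"
  shows "power_form n k \<or> Suc_form n k"
proof -
  have large: "Suc_form (2 ^ p * (2 ^ b * 3 ^ l + 1) * 3 ^ c) (2 * (p + b) + 3 * (l + c) + 1)"
    if "2 ^ b * 3 ^ l \<ge> (8 :: nat)" "\<not> (b = 0 \<and> l = 0)"
      "max_val (2 * (p + b) + 3 * (l + c)) < 2 ^ p * (2 ^ b * 3 ^ l + 1) * 3 ^ c" for p b l c
  proof -
    have "p + b \<le> 2" using Suc_form_bound[of p b l c] that by linarith
    then show ?thesis unfolding Suc_form_def using that(2) by blast
  qed
  show ?thesis
  proof (cases "p + b \<le> 2 \<or> 2 ^ b * 3 ^ l \<ge> (8 :: nat)")
    case True
    then show ?thesis
    proof
      assume "p + b \<le> 2"
      then have "Suc_form n k" unfolding Suc_form_def using assms by blast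
      then show ?thesis ..
    next
      assume "2 ^ b * 3 ^ l \<ge> (8 :: nat)"
      then show ?thesis using large[of b l p c] assms by simp
    qed
  next
    case False
    then have pb: "p + b \<ge> 3" and small: "2 ^ b * 3 ^ l < (8 :: nat)" by auto
    have "l < 2" using small by (rule exponent_less_2)
    moreover have "b = 0 \<or> b = 1 \<or> b = 2" using assms(1) by auto
    \<comment> \<open>The values of \<open>2 ^ b * 3 ^ l\<close> are 2, 3, 4, 6, with successors 3,
      4, 5, 7. The first two yield powers; for 5 and 7, \<open>p + b >= 3\<close> supplies the
      factor 2 or 4 that the identities need.\<close>
    ultimately consider "b = 1" "l = 0" | "b = 0" "l = 1" | "b = 2" "l = 0" | "b = 1" "l = 1"
      using assms(2) small by (cases l) auto
    then show ?thesis
    proof cases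
      case 1
      then have nk: "n = 2 ^ p * 3 ^ Suc c" "k = 2 * p + 3 * Suc c" using n k by auto
      show ?thesis using power_formI[of p "Suc c"] big unfolding nk by blast
    next
      case 2
      then have nk: "n = 2 ^ (p + 2) * 3 ^ c" "k = 2 * (p + 2) + 3 * c" using n k by auto
      show ?thesis using power_formI[of "p + 2" c] big unfolding nk by blast
    next
      case 3
      then obtain q where "p = Suc q" using pb by (cases p) auto
      then have nk: "n = 2 ^ q * (2 ^ 0 * 3 ^ 2 + 1) * 3 ^ c" "k = 2 * (q + 0) + 3 * (2 + c) + 1"
        using 3 n k by auto
      have "Suc_form n k" unfolding nk by (rule large) (use big nk in \<open>simp_all add: ac_simps\<close>)
      then show ?thesis ..
    next
      case 4
      then have "p = (p - 2) + 2" using pb by simp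
      then obtain q where "p = q + 2" ..
      then have nk: "n = 2 ^ q * (2 ^ 0 * 3 ^ 3 + 1) * 3 ^ c" "k = 2 * (q + 0) + 3 * (3 + c) + 1"
        using 4 n k by (auto simp: power_add)
      have "Suc_form n k" unfolding nk by (rule large) (use big nk in \<open>simp_all add: ac_simps\<close>)
      then show ?thesis ..
    qed
  qed
qed

section \<open>Products of listed forms\<close>

lemma power_form_mult:
  assumes "power_form x i" "power_form y j" "max_val (i + j - 1) < x * y"
  shows "power_form (x * y) (i + j)"
proof -
  obtain a c a' c' where "x = 2 ^ a * 3 ^ c" "i = 2 * a + 3 * c" "y = 2 ^ a' * 3 ^ c'" "j = 2 * a' + 3 * c'"
    using assms unfolding power_form_def by blast
  moreover from this have "x * y = 2 ^ (a + a') * 3 ^ (c + c')" "i + j = 2 * (a + a') + 3 * (c + c')"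
    by (auto simp: power_add)
  ultimately show ?thesis using power_formI assms(3) by metis
qed

text \<open>The power of 2 in \<open>x\<close> may push the exponent of the product beyond the limit
  of \<open>Suc_form\<close>, which is why \<open>Suc_formI\<close> admits any
  \<open>p\<close>.\<close>

lemma power_form_Suc_form_mult:
  assumes "power_form x i" "Suc_form y j" "max_val (i + j - 1) < x * y"
  shows "power_form (x * y) (i + j) \<or> Suc_form (x * y) (i + j)"
proof -
  obtain s d where x: "x = 2 ^ s * 3 ^ d" "i = 2 * s + 3 * d"
    using assms unfolding power_form_def by blast
  obtain a b c l where y: "a + b \<le> 2" "\<not> (b = 0 \<and> l = 0)" "y = 2 ^ a * (2 ^ b * 3 ^ l + 1) * 3 ^ c"
    "j = 2 * (a + b) + 3 * (l + c) + 1"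
    using assms unfolding Suc_form_def by blast
  show ?thesis
  proof (rule Suc_formI[OF _ y(2) _ _ assms(3)])
    show "b \<le> 2" using y(1) by simp
    show "x * y = 2 ^ (s + a) * (2 ^ b * 3 ^ l + 1) * 3 ^ (c + d)"
      unfolding x(1) y(3) power_add by (simp only: mult_ac)
    show "i + j = 2 * (s + a + b) + 3 * (l + (c + d)) + 1" using x y by simp
  qed
qed

text \<open>The gain (1 + 1/u)(1 + 1/v) equals 3/2 at (4, 5) and decreases in both variables; at (4,
  4) it is 25/16, which is too large.\<close>

lemma Suc_mult_Suc_le:
  assumes "u \<ge> 4" "v \<ge> 4" "\<not> (u = 4 \<and> v = (4 :: nat))"
  shows "2 * ((u + 1) * (v + 1)) \<le> 3 * (u * v)"
proof -
  have *: "2 * ((u + 1) * (v + 1)) \<le> 3 * (u * v)" if uv: "u \<ge> 4" "v \<ge> 5" for u v :: nat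
  proof -
    obtain r s where "u = 4 + r" "v = 5 + s"
      using le_Suc_ex[OF uv(1)] le_Suc_ex[OF uv(2)] by blast
    then show ?thesis by (simp add: algebra_simps)
  qed
  show ?thesis
  proof (cases "v \<ge> 5")
    case False
    then have "u \<ge> 5" using assms by auto
    then show ?thesis using *[of v u] assms by (simp add: algebra_simps)
  qed (use * assms in blast)
qed

text \<open>Against the product \<open>u * v\<close> without its two \<open>+ 1\<close>, the
  right-hand side has one spare 1. Merging it with existing factors gains at least as much as both
  \<open>+ 1\<close> together.\<close>

lemma Suc_mult_Suc_bound:
  fixes b l b' l' p c :: nat
  defines "u \<equiv> 2 ^ b * 3 ^ l" and "v \<equiv> 2 ^ b' * (3 :: nat) ^ l'"
  assumes u: "u \<ge> 4" and v: "v \<ge> 4" and bs: "b \<le> 2" "b' \<le> 2"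
  shows "2 ^ p * ((u + 1) * (v + 1)) * 3 ^ c
           \<le> max_val (2 * (p + b + b') + 3 * (l + l' + c) + 1)"
proof -
  define s where "s = p + b + b'"
  define M where "M = l + l' + c"
  have uv: "2 ^ p * (u * v) * 3 ^ c = 2 ^ s * 3 ^ M"
    unfolding u_def v_def s_def M_def power_add by (simp only: mult_ac)
  have M: "3 ^ M * max_val (2 * s + 1) \<le> max_val (2 * s + 3 * M + 1)"
    using max_val_power_3_mult_le[of M "2 * s + 1"] by (simp add: add.commute add.left_commute)
  have "2 ^ p * ((u + 1) * (v + 1)) * 3 ^ c \<le> max_val (2 * s + 3 * M + 1)"
  proof (cases "u = 4 \<and> v = 4")
    case True
    have aux: "b = 2" if "2 ^ b * (3 :: nat) ^ l = 4" "b \<le> 2" for b l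
    proof -
      have "l = 0"
      proof (rule ccontr)
        assume "l \<noteq> 0"
        then obtain l' where "l = Suc l'" by (cases l) auto
        then have "3 * (2 ^ b * 3 ^ l') = (4 :: nat)" using that(1) by simp
        then show False by presburger
      qed
      moreover have "b = 0 \<or> b = 1 \<or> b = 2" using that(2) by auto
      ultimately show ?thesis using that(1) by auto
    qed
    have "b = 2" "b' = 2" using aux bs True unfolding u_def v_def by blast+
    then obtain r where r: "s = r + 4" unfolding s_def by simp
    \<comment> \<open>Four factors 2 and the spare 1 make nine ones, worth 27 instead of 16, and 25
      <= 27.\<close>
    have "16 * (2 ^ p * ((u + 1) * (v + 1)) * 3 ^ c) = 25 * (2 ^ p * (u * v) * 3 ^ c)" using True by simp
    also have "\<dots> \<le> 16 * (3 ^ M * (2 ^ r * max_val 9))"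
      unfolding uv r by (simp add: power_add)
    also have "\<dots> \<le> 16 * max_val (2 * s + 3 * M + 1)"
    proof -
      have "2 ^ r * max_val 9 \<le> max_val (2 * s + 1)"
        using max_val_power_2_mult_le[of r 9] unfolding r by (simp only: distrib_left) (simp add: add.commute)
      then show ?thesis using M by (meson le_trans mult_le_mono2)
    qed
    finally show ?thesis by simp
  next
    case False
    show ?thesis
    proof (cases s)
      case 0
      \<comment> \<open>Without factors 2, both \<open>u\<close> and \<open>v\<close> are powers of
        3 and at least 9. The spare 1 turns a factor 3 into 4, and 100/81 <= 4/3.\<close>
      then have z: "b = 0" "b' = 0" "p = 0" unfolding s_def by auto
      have aux: "3 ^ l \<ge> (9 :: nat)" if "3 ^ l \<ge> (4 :: nat)" for l
      proof -
        have "l \<ge> 2" using that by (cases l rule: max_val.cases) auto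
        then have "(3 :: nat) ^ 2 \<le> 3 ^ l" by (intro power_increasing) auto
        then show ?thesis by simp
      qed
      have 9: "u \<ge> 9" "v \<ge> 9" using aux u v z unfolding u_def v_def by auto
      have "l \<noteq> 0" using u z unfolding u_def by (cases l) auto
      then obtain M' where M': "M = Suc M'" unfolding M_def by (cases l) auto
      have "max_val (2 * s + 3 * M + 1) = max_val (2 * 2 + 3 * M')" using 0 M' by (simp add: add.commute)
      then have mv: "3 * max_val (2 * s + 3 * M + 1) = 4 * 3 ^ M" using max_val_power_2_3[of 2 M'] M' by simp
      obtain x y where "u = 9 + x" "v = 9 + y"
        using le_Suc_ex[OF 9(1)] le_Suc_ex[OF 9(2)] by blast
      then have "3 * ((u + 1) * (v + 1)) \<le> 4 * (u * v)" by (simp add: algebra_simps)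
      then have "3 * ((u + 1) * (v + 1)) * 3 ^ c \<le> 4 * (u * v) * 3 ^ c" by (rule mult_le_mono1)
      also have "\<dots> = 3 * max_val (2 * s + 3 * M + 1)" using uv mv z(3) 0 by simp
      finally have "3 * (((u + 1) * (v + 1)) * 3 ^ c) \<le> 3 * max_val (2 * s + 3 * M + 1)"
        by (simp only: mult.assoc)
      then show ?thesis using z(3) by (simp only: mult_le_cancel1) simp
    next
      case (Suc r)
      \<comment> \<open>A factor 2 and the spare 1 make a factor 3, a gain of 3/2.\<close>
      have "2 * (2 ^ p * ((u + 1) * (v + 1)) * 3 ^ c) = 2 ^ p * (2 * ((u + 1) * (v + 1))) * 3 ^ c" by simp
      also have "\<dots> \<le> 2 ^ p * (3 * (u * v)) * 3 ^ c"
        by (intro mult_le_mono Suc_mult_Suc_le[OF u v False] le_refl)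
      also have "\<dots> = 3 * (2 ^ p * (u * v) * 3 ^ c)" by simp
      also have "\<dots> = 2 * (3 ^ M * (2 ^ r * max_val 3))"
        unfolding uv Suc by simp
      also have "\<dots> \<le> 2 * max_val (2 * s + 3 * M + 1)"
      proof -
        have "2 ^ r * max_val 3 \<le> max_val (2 * s + 1)"
          using max_val_power_2_mult_le[of r 3] unfolding Suc by (simp add: numeral_3_eq_3)
        then show ?thesis using M by (meson le_trans mult_le_mono2)
      qed
      finally show ?thesis by simp
    qed
  qed
  then show ?thesis unfolding s_def M_def .
qed

text \<open>For \<open>2 ^ b * 3 ^ l\<close> equal to 2 or 3 the successor is 3 or 4, a power form
  at the same cost; the rest meets the bound 4 of \<open>Suc_mult_Suc_bound\<close>.\<close>

lemma Suc_form_cases: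
  assumes "Suc_form n k"
  obtains "power_form n k"
  | a b c l where "b \<le> 2" "2 ^ b * 3 ^ l \<ge> (4 :: nat)"
      "n = 2 ^ a * (2 ^ b * 3 ^ l + 1) * 3 ^ c" "k = 2 * (a + b) + 3 * (l + c) + 1"
proof -
  obtain a b c l where h: "a + b \<le> 2" "\<not> (b = 0 \<and> l = 0)"
    "n = 2 ^ a * (2 ^ b * 3 ^ l + 1) * 3 ^ c" "k = 2 * (a + b) + 3 * (l + c) + 1"
    using assms unfolding Suc_form_def by blast
  show thesis
  proof (cases "2 ^ b * 3 ^ l \<ge> (4 :: nat)")
    case True
    have "b \<le> 2" using h(1) by simp
    then show thesis using True h(3,4) by (rule that(2))
  next
    case False
    have "l < 2" using False by (intro exponent_less_2[of b]) simp
    moreover have "b = 0 \<or> b = 1 \<or> b = 2" using h(1) by auto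
    ultimately consider "b = 1" "l = 0" | "b = 0" "l = 1"
      using h(2) False by (cases l) auto
    then have "power_form n k"
    proof cases
      case 1
      then have "n = 2 ^ a * 3 ^ Suc c" "k = 2 * a + 3 * Suc c" using h by auto
      moreover have "a \<le> 10" using h by simp
      ultimately show ?thesis unfolding power_form_def by blast
    next
      case 2
      then have "n = 2 ^ (a + 2) * 3 ^ c" "k = 2 * (a + 2) + 3 * c" using h by auto
      moreover have "a + 2 \<le> 10" using h by simp
      ultimately show ?thesis unfolding power_form_def by (metis add_is_0 zero_neq_numeral)
    qed
    then show thesis by (rule that(1))
  qed
qed

lemma forms_mult:
  assumes "power_form x i \<or> Suc_form x i" "power_form y j \<or> Suc_form y j"
    and big: "max_val (i + j - 1) < x * y"
  shows "power_form (x * y) (i + j) \<or> Suc_form (x * y) (i + j)"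
proof -
  have big': "max_val (j + i - 1) < y * x" using big by (simp add: ac_simps)
  consider "power_form x i" | "power_form y j" | "Suc_form x i" "Suc_form y j" using assms by blast
  then show ?thesis
  proof cases
    case 1
    then show ?thesis using power_form_mult power_form_Suc_form_mult assms(2) big by blast
  next
    case 2
    then have "power_form (y * x) (j + i) \<or> Suc_form (y * x) (j + i)"
      using power_form_mult power_form_Suc_form_mult assms(1) big' by blast
    then show ?thesis by (simp add: ac_simps)
  next
    case 3
    show ?thesis
    proof (rule Suc_form_cases[OF 3(1)])
      assume "power_form x i"
      then show ?thesis using power_form_Suc_form_mult 3 big by blast
    next
      fix a b c l
      assume x: "b \<le> 2" "2 ^ b * 3 ^ l \<ge> (4 :: nat)"
        "x = 2 ^ a * (2 ^ b * 3 ^ l + 1) * 3 ^ c" "i = 2 * (a + b) + 3 * (l + c) + 1"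
      show ?thesis
      proof (rule Suc_form_cases[OF 3(2)])
        assume "power_form y j"
        then have "power_form (y * x) (j + i) \<or> Suc_form (y * x) (j + i)"
          using power_form_Suc_form_mult 3 big' by blast
        then show ?thesis by (simp add: ac_simps)
      next
        fix a' b' c' l'
        assume y: "b' \<le> 2" "2 ^ b' * 3 ^ l' \<ge> (4 :: nat)"
          "y = 2 ^ a' * (2 ^ b' * 3 ^ l' + 1) * 3 ^ c'" "j = 2 * (a' + b') + 3 * (l' + c') + 1"
        have "x * y = 2 ^ (a + a') * ((2 ^ b * 3 ^ l + 1) * (2 ^ b' * 3 ^ l' + 1)) * 3 ^ (c + c')"
          unfolding x(3) y(3) power_add by (simp only: mult_ac)
        also have "\<dots> \<le> max_val (2 * (a + a' + b + b') + 3 * (l + l' + (c + c')) + 1)"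
          using Suc_mult_Suc_bound x y by blast
        \<comment> \<open>Of the two ones from the \<open>+ 1\<close> terms, the subtraction leaves
          one: the spare 1 of the bound.\<close>
        also have "2 * (a + a' + b + b') + 3 * (l + l' + (c + c')) + 1 = i + j - 1" using x(4) y(4) by simp
        finally show ?thesis using big by simp
      qed
    qed
  qed
qed

section \<open>Sums\<close>

lemma forms_add:
  assumes "x \<le> max_val i" "y \<le> max_val j" "1 \<le> j" "j \<le> i"
    and big: "max_val (i + j - 1) < x + y"
  shows "power_form (x + y) (i + j) \<or> Suc_form (x + y) (i + j)"
proof -
  have two: "power_form 2 2" unfolding power_form_def by (rule exI[of _ 1], rule exI[of _ 0]) simp
  have four: "power_form 4 4" unfolding power_form_def by (rule exI[of _ 2], rule exI[of _ 0]) simp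
  have five: "Suc_form 5 5" unfolding Suc_form_def
    by (rule exI[of _ 0], rule exI[of _ 2], rule exI[of _ 0], rule exI[of _ 0]) simp
  consider "j = 1" | "j = 2" | "j \<ge> 3" using assms(3) by linarith
  then show ?thesis
  proof cases
    case 1
    then have xy: "x + y = max_val i + 1" using assms by auto
    show ?thesis
    proof (cases "i = 1")
      case True
      then have "x + y = 2" "i + j = 2" using xy 1 by auto
      then show ?thesis using two by simp
    next
      case False
      then have i: "i \<ge> 2" using assms by simp
      then obtain b l where b: "b \<le> 2" "i = 2 * b + 3 * l" "max_val i = 2 ^ b * 3 ^ l"
        by (rule max_val_eq_power_2_3)
      have "Suc_form (x + y) (i + j)"
        unfolding Suc_form_def
        by (rule exI[of _ 0], rule exI[of _ b], rule exI[of _ 0], rule exI[of _ l]) (use b i xy 1 in auto)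
      then show ?thesis ..
    qed
  next
    case 2
    have y: "y \<le> 2" using assms(2) 2 by (simp add: eval_nat_numeral)
    consider "i = 2" | "i = 3" | "i = 4" | m where "i = Suc (Suc (Suc (Suc (Suc m))))"
      using assms(4) 2 by (cases i rule: max_val.cases) auto
    then show ?thesis
    proof cases
      case 1
      then have "x + y = 4" "i + j = 4" using 2 y assms by (auto simp: eval_nat_numeral)
      then show ?thesis using four by simp
    next
      case 2
      then have "x + y = 5" "i + j = 5" using \<open>j = 2\<close> y assms by (auto simp: eval_nat_numeral)
      then show ?thesis using five by simp
    next
      case 3
      \<comment> \<open>The sum is at most 6 = \<open>max_val 5\<close>, contradicting
        \<open>big\<close>.\<close>
      then show ?thesis using 2 y assms by (auto simp: eval_nat_numeral)
    next
      case (4 m)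
      \<comment> \<open>Tripling strict growth gives
        \<open>max_val (i + 1) >= max_val i + 3\<close>, while the sum is at most
        \<open>max_val i + 2\<close>.\<close>
      have "i + j - 1 = (m + 3) + 3" "i = (m + 2) + 3" using 4 2 by auto
      then have "max_val (i + j - 1) = 3 * max_val (m + 3)" "max_val i = 3 * max_val (m + 2)"
        using max_val_add_3[of "m + 3"] max_val_add_3[of "m + 2"] by simp_all
      moreover have "Suc (max_val (m + 2)) \<le> max_val (m + 3)"
        using Suc_max_val_le[of "m + 2"] by (simp add: eval_nat_numeral)
      ultimately show ?thesis using big assms(1) y by linarith
    qed
  next
    case 3
    \<comment> \<open>The sum is at most twice \<open>max_val i\<close>, and doubling costs two
      ones, which \<open>j - 1\<close> covers.\<close>
    have "x + y \<le> max_val (i + j - 1)"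
    proof (cases "j = 3")
      case True
      have "2 * max_val i \<le> max_val (i + 2)"
        using max_val_mult_le[of 2 i] by (simp add: add.commute)
      moreover have "max_val i \<ge> 3" using max_val_mono[of 3 i] 3 assms(4) by simp
      moreover have "max_val j = 3" using True by simp
      ultimately show ?thesis using True assms by simp
    next
      case False
      have "max_val j \<le> max_val i" using assms(4) by (rule max_val_mono)
      moreover have "2 * max_val i \<le> max_val (i + 2)"
        using max_val_mult_le[of 2 i] by (simp add: add.commute)
      moreover have "max_val (i + 2) \<le> max_val (i + j - 1)" using 3 by (intro max_val_mono) simp
      ultimately show ?thesis using assms by linarith
    qed
    then show ?thesis using big by simp
  qed
qed

section \<open>Induction on expressions and the final equivalence\<close>

lemma expr_forms:
  "max_val (ones t - 1) < val t \<Longrightarrow> power_form (val t) (ones t) \<or> Suc_form (val t) (ones t)"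
proof (induction t)
  \<comment> \<open>The premise is false since \<open>max_val 0 = 1\<close>; the value 1 is left to
    the theorem.\<close>
  case One
  then show ?case by simp
next
  case (Add s t)
  show ?case
  proof (cases "ones t \<le> ones s")
    case True
    then show ?thesis
      using forms_add[OF val_le_max_val val_le_max_val ones_pos True] Add.prems by simp
  next
    case False
    then have "ones s \<le> ones t" by simp
    from forms_add[OF val_le_max_val val_le_max_val ones_pos this] Add.prems
    show ?thesis by (simp add: add.commute)
  qed
next
  case (Mult s t)
  \<comment> \<open>Stated for arbitrary expressions so that it applies to both factors by
    symmetry.\<close>
  have factor: "max_val (ones s - 1) < val s"
    if "max_val (ones s + ones t - 1) < val s * val t" for s t
  proof -
    have "max_val (ones s - 1) * val t \<le> max_val (ones s - 1) * max_val (ones t)"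
      using val_le_max_val by simp
    also have "\<dots> \<le> max_val (ones s + ones t - 1)"
      using max_val_mult_le[of "ones s - 1" "ones t"] ones_pos[of s] by simp
    also note that
    finally show ?thesis by simp
  qed
  have "max_val (ones s - 1) < val s" "max_val (ones t - 1) < val t"
    using factor[of s t] factor[of t s] Mult.prems by (simp_all add: ac_simps)
  then show ?case using forms_mult Mult by simp
qed

theorem theorem5p1:
  fixes n :: nat
  assumes "n \<ge> 1"
  shows "(D n \<le> 1 \<longleftrightarrow>
            n = 1 \<or>
            (\<exists>a k. a \<le> 10 \<and> \<not> (a = 0 \<and> k = 0) \<and> n = 2 ^ a * 3 ^ k) \<or>
            (\<exists>a b k l. a + b \<le> 2 \<and> \<not> (b = 0 \<and> l = 0) \<and>
               n = 2 ^ a * (2 ^ b * 3 ^ l + 1) * 3 ^ k)) \<and>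
         (n = 1 \<longrightarrow> complexity n = 1) \<and>
         (\<forall>a k. a \<le> 10 \<and> \<not> (a = 0 \<and> k = 0) \<and> n = 2 ^ a * 3 ^ k \<longrightarrow>
            complexity n = 2 * a + 3 * k) \<and>
         (\<forall>a b k l. a + b \<le> 2 \<and> \<not> (b = 0 \<and> l = 0) \<and>
            n = 2 ^ a * (2 ^ b * 3 ^ l + 1) * 3 ^ k \<longrightarrow>
            complexity n = 2 * (a + b) + 3 * (l + k) + 1)"
proof (intro conjI)
  have power: "complexity n = k \<and> D n \<le> 1" if "power_form n k" for k
  proof -
    have "writable n k" using that writable_power_2_3 unfolding power_form_def by blast
    then have k: "complexity n = k" using complexity_eqI max_val_less_power_form that by blast
    moreover have "n \<ge> 2" using max_val_less_power_form[OF that] max_val_pos[of "k - 1"] by simp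
    ultimately show ?thesis using D_le_1_iff max_val_less_power_form[OF that] by blast
  qed
  have Suc: "complexity n = k \<and> D n \<le> 1" if "Suc_form n k" for k
  proof -
    have "writable n k" using that writable_Suc_form unfolding Suc_form_def by blast
    then have k: "complexity n = k" using complexity_eqI max_val_less_Suc_form that by blast
    moreover have "n \<ge> 2" using max_val_less_Suc_form[OF that] max_val_pos[of "k - 1"] by simp
    ultimately show ?thesis using D_le_1_iff max_val_less_Suc_form[OF that] by blast
  qed
  have one: "complexity 1 = 1"
    using complexity_le[OF writable_1] complexity_pos[of 1] by simp
  then show "n = 1 \<longrightarrow> complexity n = 1" by blast
  show "\<forall>a k. a \<le> 10 \<and> \<not> (a = 0 \<and> k = 0) \<and> n = 2 ^ a * 3 ^ k \<longrightarrow> complexity n = 2 * a + 3 * k"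
    using power unfolding power_form_def by blast
  show "\<forall>a b k l. a + b \<le> 2 \<and> \<not> (b = 0 \<and> l = 0) \<and> n = 2 ^ a * (2 ^ b * 3 ^ l + 1) * 3 ^ k \<longrightarrow>
      complexity n = 2 * (a + b) + 3 * (l + k) + 1"
    using Suc unfolding Suc_form_def by blast
  \<comment> \<open>This value lies outside \<open>D_le_1_iff\<close> and is computed
    directly.\<close>
  have "D n \<le> 1" if "n = 1"
  proof -
    have "1 \<le> L n" using le_L_iff[of n 1] assms by simp
    then show ?thesis unfolding D_def using one that by simp
  qed
  moreover have "(\<exists>k. power_form n k) \<or> (\<exists>k. Suc_form n k)" if "D n \<le> 1" "n \<noteq> 1"
  proof -
    \<comment> \<open>An optimal expression turns the defect condition into the premise of
      \<open>expr_forms\<close>.\<close>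
    obtain t where "val t = n" "ones t = complexity n"
      using writable_complexity[OF assms] unfolding writable_def by blast
    moreover have "max_val (complexity n - 1) < n" using D_le_1_iff[of n] that assms by simp
    ultimately show ?thesis using expr_forms[of t] by auto
  qed
  ultimately have "D n \<le> 1 \<longleftrightarrow> n = 1 \<or> (\<exists>k. power_form n k) \<or> (\<exists>k. Suc_form n k)"
    using power Suc by blast
  then show "D n \<le> 1 \<longleftrightarrow>
            n = 1 \<or>
            (\<exists>a k. a \<le> 10 \<and> \<not> (a = 0 \<and> k = 0) \<and> n = 2 ^ a * 3 ^ k) \<or>
            (\<exists>a b k l. a + b \<le> 2 \<and> \<not> (b = 0 \<and> l = 0) \<and>
               n = 2 ^ a * (2 ^ b * 3 ^ l + 1) * 3 ^ k)"
    unfolding power_form_def Suc_form_def by blast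
qed

end
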